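(* (1) $h=(h_{ABC})\in\otimes^3\mathbb C^k$ belongs to $V_{210\dots}$ if and only if $$h_{[A\underline BC]}+h_{[A\underline CB]}=\tfrac32h_{ABC}\quad\text{for all }A,B,C.$$ Moreover, for any $h\in V_{210\dots}$, $h_{ABC}=h_{ACB}$ for all $A,B,C$. (2) $h=(h_{DABC})\in\otimes^4\mathbb C^k$ belongs to $V_{220\dots}$ if and only if $$h_{DABC}=\tfrac16\sum_{(A,D),(B,C)}\big(h_{D[A\underline BC]}+h_{B[C\underline DA]}\big)\quad\text{for all }D,A,B,C.$$ (3) $h=(h_{EDABC})\in\otimes^5\mathbb C^k$ belongs to $V_{3110\dots}$ if and only if $$\sum_{(D,B,C)}h_{[E\underline DA\underline BC]}=\tfrac{10}3h_{EDABC}\quad\text{for all }E,D,A,B,C.$$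
   Context: All indices run over $0,\dots,k-1$; an element of $\otimes^l\mathbb C^k$ is identified with its tuple of components with respect to the basis $\omega^{A_1}\otimes\cdots\otimes\omega^{A_l}$, where $\omega^0,\dots,\omega^{k-1}$ is a basis of $\mathbb C^k$. Brackets $[\cdots]$ denote skewsymmetrization, $f_{[A_1\cdots A_p]}=\frac1{p!}\sum_{\sigma\in S_p}\mathrm{sign}(\sigma)f_{A_{\sigma(1)}\cdots A_{\sigma(p)}}$; underlined indices inside a bracket stay in place and are not skewsymmetrized. Thus $h_{[A\underline BC]}=\frac12(h_{ABC}-h_{CBA})$, $h_{D[A\underline BC]}=\frac12(h_{DABC}-h_{DCBA})$, $h_{B[C\underline DA]}=\frac12(h_{BCDA}-h_{BADC})$, and $h_{[E\underline DA\underline BC]}=\frac16\sum_{\sigma}\mathrm{sign}(\sigma)h_{\sigma(E)D\sigma(A)B\sigma(C)}$ over the permutations $\sigma$ of the three index letters $E,A,C$. $\sum_{(B,\dots,C)}$ denotes the sum over all permutations of the listed indices (so $\sum_{(A,D),(B,C)}$ has four terms and $\sum_{(D,B,C)}$ has six). The spaces $V_{210\dots}$, $V_{220\dots}$, $V_{3110\dots}$ (Weyl modules, irreducible $\mathrm{GL}(k)$-modules) are defined as the images of the following linear maps (normalized Young symmetrizers): $C_{21}:\otimes^3\mathbb C^k\to\otimes^3\mathbb C^k$, $C_{21}(h)_{ABC}=\frac23\sum_{(B,C)}h_{[A\underline BC]}$; $C_{22}:\otimes^4\mathbb C^k\to\otimes^4\mathbb C^k$, $C_{22}(h)_{DABC}=\frac16\sum_{(A,D),(B,C)}\big(h_{D[A\underline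 BC]}+h_{B[C\underline DA]}\big)$; $C_{311}:\otimes^5\mathbb C^k\to\otimes^5\mathbb C^k$, $C_{311}(h)_{EDABC}=\frac3{10}\sum_{(D,B,C)}h_{[E\underline DA\underline BC]}$. *)

theory Defs
  imports "HOL-Analysis.Analysis" "HOL-Combinatorics.Combinatorics"
begin

text \<open>
  The index set is a finite type \<open>'k\<close> with \<open>k = CARD('k)\<close>. An element of the
  \<open>l\<close>-fold tensor power of \<open>\<complex>\<^sup>k\<close> is its tuple of components, i.e. a complex vector
  indexed by \<open>l\<close>-tuples over \<open>'k\<close>.
\<close>

type_synonym 'k tensor3 = "complex ^ ('k \<times> 'k \<times> 'k)"
type_synonym 'k tensor4 = "complex ^ ('k \<times> 'k \<times> 'k \<times> 'k)"
type_synonym 'k tensor5 = "complex ^ ('k \<times> 'k \<times> 'k \<times> 'k \<times> 'k)"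

text \<open>
  Permutations act on the positions of an index list, not on the index values, so
  terms are counted with multiplicity when some of the listed indices coincide.
\<close>

definition skew :: "('k list \<Rightarrow> complex) \<Rightarrow> 'k list \<Rightarrow> complex" where
  "skew f As = 1 / fact (length As) *
     (\<Sum>\<sigma> | \<sigma> permutes {..<length As}. of_int (sign \<sigma>) * f (permute_list \<sigma> As))"

definition sum_perms :: "('k list \<Rightarrow> complex) \<Rightarrow> 'k list \<Rightarrow> complex" where
  "sum_perms f As = (\<Sum>\<sigma> | \<sigma> permutes {..<length As}. f (permute_list \<sigma> As))"

text \<open>
  \<open>skew3 h A B C\<close> is \<open>h\<^bsub>[ABC]\<^esub>\<close> with \<open>B\<close> underlined, \<open>skew4 h D A B C\<close> is
  \<open>h\<^bsub>D[ABC]\<^esub>\<close> with \<open>B\<close> underlined, and \<open>skew5 h E D A B C\<close> is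
  \<open>h\<^bsub>[EDABC]\<^esub>\<close> with \<open>D\<close> and \<open>B\<close> underlined.
\<close>

definition skew3 :: "('k::finite) tensor3 \<Rightarrow> 'k \<Rightarrow> 'k \<Rightarrow> 'k \<Rightarrow> complex" where
  "skew3 h A B C = skew (\<lambda>X. h $ (X ! 0, B, X ! 1)) [A, C]"

definition skew4 :: "('k::finite) tensor4 \<Rightarrow> 'k \<Rightarrow> 'k \<Rightarrow> 'k \<Rightarrow> 'k \<Rightarrow> complex" where
  "skew4 h D A B C = skew (\<lambda>X. h $ (D, X ! 0, B, X ! 1)) [A, C]"

definition skew5 :: "('k::finite) tensor5 \<Rightarrow> 'k \<Rightarrow> 'k \<Rightarrow> 'k \<Rightarrow> 'k \<Rightarrow> 'k \<Rightarrow> complex" where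
  "skew5 h E D A B C = skew (\<lambda>X. h $ (X ! 0, D, X ! 1, B, X ! 2)) [E, A, C]"

definition C21 :: "('k::finite) tensor3 \<Rightarrow> 'k tensor3" where
  "C21 h = vec_lambda (\<lambda>(A, B, C).
     2 / 3 * sum_perms (\<lambda>X. skew3 h A (X ! 0) (X ! 1)) [B, C])"

text \<open>In \<open>C22\<close>, \<open>X\<close> runs over the permutations of \<open>[A, D]\<close> and \<open>Y\<close> over those of \<open>[B, C]\<close>.\<close>

definition C22 :: "('k::finite) tensor4 \<Rightarrow> 'k tensor4" where
  "C22 h = vec_lambda (\<lambda>(D, A, B, C).
     1 / 6 * sum_perms (\<lambda>X. sum_perms (\<lambda>Y.
         skew4 h (X ! 1) (X ! 0) (Y ! 0) (Y ! 1) + skew4 h (Y ! 0) (Y ! 1) (X ! 1) (X ! 0))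
       [B, C]) [A, D])"

definition C311 :: "('k::finite) tensor5 \<Rightarrow> 'k tensor5" where
  "C311 h = vec_lambda (\<lambda>(E, D, A, B, C).
     3 / 10 * sum_perms (\<lambda>X. skew5 h E (X ! 0) A (X ! 1) (X ! 2)) [D, B, C])"

definition V210 :: "('k::finite) tensor3 set" where
  "V210 = range C21"

definition V220 :: "('k::finite) tensor4 set" where
  "V220 = range C22"

definition V3110 :: "('k::finite) tensor5 set" where
  "V3110 = range C311"

lemma sum_permutes_2:
  "(\<Sum>\<sigma> | \<sigma> permutes {..<2::nat}. F \<sigma>) = F id + F (Transposition.transpose 0 1)"
proof -
  have eq: "{..<2::nat} = insert 0 (insert 1 {})" by auto
  show ?thesis
    unfolding eq by (simp add: sum_over_permutations_insert)
qed

lemma sum_permutes_3: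
  "(\<Sum>\<sigma> | \<sigma> permutes {..<3::nat}. F \<sigma>) =
     F id + F (Transposition.transpose 1 2)
     + F (Transposition.transpose 0 1) + F (Transposition.transpose 0 1 \<circ> Transposition.transpose 1 2)
     + F (Transposition.transpose 0 2) + F (Transposition.transpose 0 2 \<circ> Transposition.transpose 1 2)"
proof -
  have eq: "{..<3::nat} = insert 0 (insert 1 (insert 2 {}))" by auto
  show ?thesis
    unfolding eq by (simp add: sum_over_permutations_insert add.assoc)
qed

lemma sum_perms_2: "sum_perms f [A, B] = f [A, B] + f [B, A]"
  by (simp add: sum_perms_def sum_permutes_2 permute_list_def upt_rec flip: numeral_2_eq_2)

lemma skew_2: "skew f [A, B] = 1 / 2 * (f [A, B] - f [B, A])"
  by (simp add: skew_def sum_permutes_2 permute_list_def upt_rec sign_swap_id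
      flip: numeral_2_eq_2)

lemma sum_perms_3:
  "sum_perms f [A, B, C] =
     f [A, B, C] + f [A, C, B] + f [B, A, C] + f [B, C, A] + f [C, A, B] + f [C, B, A]"
  by (simp add: sum_perms_def sum_permutes_3 permute_list_def upt_rec Transposition.transpose_def
      flip: numeral_3_eq_3)

lemma skew_3:
  "skew f [A, B, C] = 1 / 6 *
     (f [A, B, C] - f [A, C, B] - f [B, A, C] + f [B, C, A] + f [C, A, B] - f [C, B, A])"
proof -
  have sgn: "sign (Transposition.transpose (0::nat) a \<circ> Transposition.transpose 1 2) =
      sign (Transposition.transpose (0::nat) a) * sign (Transposition.transpose 1 (2::nat))" for a
    by (simp add: sign_compose permutation_swap_id)
  have len: "length [A, B, C] = 3"
    by simp
  show ?thesis
    unfolding skew_def len sum_permutes_3 sgn sign_id sign_swap_id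
    by (simp add: permute_list_def upt_rec Transposition.transpose_def fact_numeral)
qed

lemma skew3_eq: "skew3 h A B C = 1 / 2 * (h $ (A, B, C) - h $ (C, B, A))"
  by (simp add: skew3_def skew_2)

lemma skew4_eq: "skew4 h D A B C = 1 / 2 * (h $ (D, A, B, C) - h $ (D, C, B, A))"
  by (simp add: skew4_def skew_2)

lemma skew5_eq:
  "skew5 h E D A B C = 1 / 6 *
     (h $ (E, D, A, B, C) - h $ (E, D, C, B, A) - h $ (A, D, E, B, C)
      + h $ (A, D, C, B, E) + h $ (C, D, E, B, A) - h $ (C, D, A, B, E))"
  by (simp add: skew5_def skew_3)

lemma linear_C21: "Vector_Spaces.linear (*s) (*s) (C21 :: ('k::finite) tensor3 \<Rightarrow> _)"
  by unfold_locales
    (auto simp: C21_def vec_eq_iff skew3_eq sum_perms_2 algebra_simps)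

lemma linear_C22: "Vector_Spaces.linear (*s) (*s) (C22 :: ('k::finite) tensor4 \<Rightarrow> _)"
  by unfold_locales
    (auto simp: C22_def vec_eq_iff skew4_eq sum_perms_2 algebra_simps)

lemma linear_C311: "Vector_Spaces.linear (*s) (*s) (C311 :: ('k::finite) tensor5 \<Rightarrow> _)"
  by unfold_locales
    (auto simp: C311_def vec_eq_iff skew5_eq sum_perms_3 algebra_simps)

end

theory Submission
  imports Defs
begin

text \<open>
  Each of the three maps has the form \<open>C = c \<cdot> P \<circ> Q\<close>, where \<open>Q\<close> antisymmetrizes over the columns
  of a Young tableau and \<open>P\<close> sums over the permutations of its rows. The linear systems say
  \<open>C h = h\<close>, so they characterize the image of \<open>C\<close> as soon as \<open>C\<close> is idempotent. An element of the
  image is, up to a factor, some \<open>g = P k\<close> with \<open>k\<close> alternating along the columns, and what has to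
  be shown is \<open>P (Q g) = g / c\<close>.

  Write out \<open>P k\<close>, apply \<open>Q\<close> to every summand, and apply \<open>P\<close> again. Two things can happen to a
  resulting summand \<open>k(\<dots>)\<close>. Either two indices of one row have landed in one column of \<open>k\<close>; then
  symmetrizing over the row annihilates it, because \<open>k\<close> changes sign under their exchange. Or the
  indices can be carried back to their original places by a column permutation and a row
  permutation; then it contributes a multiple of \<open>g\<close>. Counting the second kind, with signs and
  weights, gives \<open>1 / c\<close>, which is \<open>3 / 2\<close>, \<open>6\<close> and \<open>10 / 3\<close> for the shapes (2,1), (2,2) and
  (3,1,1). These counts are \<open>C21_eq_selfI\<close>, \<open>C22_eq_selfI\<close> and \<open>C311_eq_selfI\<close>.

  The symmetry of the elements of \<open>V210\<close> in their last two indices is the symmetry of \<open>P\<close>.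
\<close>

lemma range_idempotent_iff:
  assumes "\<And>x. C (C x) = C x"
  shows "y \<in> range C \<longleftrightarrow> C y = y"
  using assms by (metis rangeE rangeI)

lemma C21_nth: "C21 h $ (A, B, C) = 2 / 3 * (skew3 h A B C + skew3 h A C B)"
  by (simp add: C21_def sum_perms_2)

text \<open>
  The only unwanted summand is \<open>k C A B\<close>: the row indices \<open>B\<close> and \<open>C\<close> share the column of \<open>k\<close>
  formed by its first and third slot, so the summand cancels against \<open>k B A C\<close>.
  The antisymmetrizer fixes \<open>k A B C\<close> and keeps half of \<open>k A C B\<close>, so the count is \<open>1 + 1 / 2\<close>.
\<close>
lemma C21_eq_selfI:
  assumes alt: "\<And>A B C. k C B A = - k A B C"
    and g: "\<And>A B C. g $ (A, B, C) = k A B C + k A C B"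
  shows "C21 g = g"
proof -
  have skew: "skew3 g A B C = k A B C + (k A C B - k C A B) / 2" for A B C
    using alt[of A B C] by (simp add: skew3_eq g field_simps)
  have "C21 g $ (A, B, C) = g $ (A, B, C)" for A B C
    using alt[of C A B] by (simp add: C21_nth skew g field_simps)
  then show ?thesis
    by (simp add: vec_eq_iff)
qed

lemma C21_idem: "C21 (C21 h) = C21 h"
proof (rule C21_eq_selfI)
  show "2 / 3 * skew3 h C B A = - (2 / 3 * skew3 h A B C)" for A B C
    by (simp add: skew3_eq field_simps)
  show "C21 h $ (A, B, C) = 2 / 3 * skew3 h A B C + 2 / 3 * skew3 h A C B" for A B C
    by (simp add: C21_nth distrib_left)
qed

lemma C22_nth:
  "C22 h $ (D, A, B, C) = 1 / 6 * sum_perms (\<lambda>X. sum_perms (\<lambda>Y.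
       skew4 h (X ! 1) (X ! 0) (Y ! 0) (Y ! 1) + skew4 h (Y ! 0) (Y ! 1) (X ! 1) (X ! 0))
     [B, C]) [A, D]"
  by (simp add: C22_def)

text \<open>
  The columns of the tableau are the slots 1, 3 and the slots 2, 4; its rows are the slots 1, 2
  and the slots 3, 4. The sum of the two brackets is twice the antisymmetrizer over both columns. It
  therefore doubles \<open>k D A B C\<close> and \<open>k A D C B\<close>, which alternate along these columns already, and
  either of them contributes \<open>2\<close> to the count. Exchanging the entries of one row only gives the
  other two summands of \<open>g\<close>. From each of these the antisymmetrization over both columns makes
  four summands with weight \<open>1 / 2\<close>; two of them have both indices of a row in one column of \<open>k\<close>
  and cancel, and the other two contribute \<open>1\<close> together. The count is \<open>2 + 2 + 1 + 1 = 6\<close>.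
\<close>
lemma C22_eq_selfI:
  assumes alt13: "\<And>D A B C. k B A D C = - k D A B C"
    and alt24: "\<And>D A B C. k D C B A = - k D A B C"
    and g: "\<And>D A B C. g $ (D, A, B, C) = k D A B C + k A D B C + k D A C B + k A D C B"
  shows "C22 g = g"
proof -
  \<comment> \<open>The sum of the two brackets turns the summand \<open>k A D B C\<close> of \<open>g\<close> into \<open>m D A B C\<close>, and
    \<open>k D A C B\<close> into \<open>m A D C B\<close>.\<close>
  define m where "m D A B C = (k A D B C - k C D B A - k A B D C + k C B D A) / 2" for D A B C
  have both: "k B C D A = k D A B C" for D A B C
    using alt13 alt24 by (metis minus_minus)
  have skew: "skew4 g D A B C + skew4 g B C D A
      = 2 * k D A B C + 2 * k A D C B + m D A B C + m A D C B" for D A B C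
    using alt13[of D A B C] alt24[of D A B C] alt13[of A D C B] alt24[of A D C B]
    by (simp add: skew4_eq g m_def both[of D A B C] both[of A D C B] field_simps)
  have sum_m: "m D A B C + m A D B C + m D A C B + m A D C B = g $ (D, A, B, C)" for D A B C
    \<comment> \<open>These instances cancel the summands having both row indices \<open>B, C\<close>, or both row indices
      \<open>A, D\<close>, in the first column of \<open>k\<close>.\<close>
    using alt13[of C D B A] alt13[of C A B D] alt13[of A B D C] alt13[of A C D B]
    by (simp add: m_def g both[of D A C B] both[of A D C B] both[of D A B C] both[of A D B C]
        field_simps)
  have "C22 g $ (D, A, B, C)
      = 1 / 6 * (4 * g $ (D, A, B, C) + 2 * (m D A B C + m A D B C + m D A C B + m A D C B))"
    for D A B C
    by (simp add: C22_nth sum_perms_2 skew) (simp add: g field_simps)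
  then have "C22 g $ (D, A, B, C) = g $ (D, A, B, C)" for D A B C
    by (simp add: sum_m)
  then show ?thesis
    by (simp add: vec_eq_iff)
qed

lemma C22_idem: "C22 (C22 h) = C22 h"
proof (rule C22_eq_selfI)
  define k where "k D A B C = 1 / 6 * (skew4 h D A B C + skew4 h B C D A)" for D A B C
  show "k B A D C = - k D A B C" for D A B C
    by (simp add: k_def skew4_eq field_simps)
  show "k D C B A = - k D A B C" for D A B C
    by (simp add: k_def skew4_eq field_simps)
  show "C22 h $ (D, A, B, C) = k D A B C + k A D B C + k D A C B + k A D C B" for D A B C
    by (simp add: k_def C22_nth sum_perms_2 algebra_simps)
qed

lemma C311_nth:
  "C311 h $ (E, D, A, B, C) =
     3 / 10 * sum_perms (\<lambda>X. skew5 h E (X ! 0) A (X ! 1) (X ! 2)) [D, B, C]"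
  by (simp add: C311_def)

text \<open>
  The column is formed by the slots 1, 3, 5 and the long row by the slots 2, 4, 5, so they share
  slot 5. As \<open>k\<close> is symmetric in the slots 2 and 4 already, its symmetrization over the row is
  \<open>2 \<cdot> g\<close>, where \<open>g\<close> has one summand for each index that can stand in slot 5. Antisymmetrizing \<open>g\<close>
  over the column leaves the first summand unchanged, and this contributes \<open>2\<close> to the count. The
  second summand becomes the mean \<open>t / 3\<close> of three terms, according to which of \<open>E, A, C\<close> comes to
  slot 4. If this is \<open>C\<close>, then the indices of the row fill the row, and the contribution is \<open>2 / 3\<close>.
  If it is \<open>E\<close> or \<open>A\<close>, then \<open>C\<close> stays in the column of \<open>k\<close> together with \<open>B\<close>, and the term cancels.
  The third summand is the second one with \<open>B\<close> and \<open>D\<close> exchanged. The count is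
  \<open>2 + 2 / 3 + 2 / 3 = 10 / 3\<close>.
\<close>
lemma C311_eq_selfI:
  assumes alt13: "\<And>E D A B C. k A D E B C = - k E D A B C"
    and alt35: "\<And>E D A B C. k E D C B A = - k E D A B C"
    and sym24: "\<And>E D A B C. k E B A D C = k E D A B C"
    and g: "\<And>E D A B C. g $ (E, D, A, B, C) = k E D A B C + k E D A C B + k E B A C D"
  shows "C311 g = g"
proof -
  define t where "t E D A B C = k E D A C B + k C D E A B + k A D C E B" for E D A B C
  have cyc: "k A D C B E = k E D A B C" "k C D E B A = k E D A B C" for E D A B C
    by (metis alt13 alt35 minus_minus)+
  have alt15: "k C D A B E = - k E D A B C" for E D A B C
    by (metis alt13 alt35 minus_minus)
  have skew: "skew5 g E D A B C = k E D A B C + (t E D A B C + t E B A D C) / 3" for E D A B C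
    using alt13[of E D A B C] alt35[of E D A B C] alt15[of E D A B C] cyc[of E D A B C]
      alt13[of E D A C B] alt13[of C D E A B] alt13[of A D C E B]
      alt13[of E B A C D] alt13[of C B E A D] alt13[of A B C E D]
    by (simp add: skew5_eq g t_def field_simps)
  have sum_k: "sum_perms (\<lambda>X. k E (X ! 0) A (X ! 1) (X ! 2)) [D, B, C] = 2 * g $ (E, D, A, B, C)"
    for E D A B C
    by (simp add: sum_perms_3 g sym24[of E B A D C] sym24[of E C A D B] sym24[of E C A B D])
  have sum_t: "sum_perms (\<lambda>X. t E (X ! 0) A (X ! 1) (X ! 2)) [D, B, C] = 2 * g $ (E, D, A, B, C)"
    for E D A B C
    \<comment> \<open>The first summand of \<open>t\<close> accounts for the right-hand side; the instances cancel the others.\<close>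
    using sum_k[of E A D B C] alt15[of B D E A C] alt15[of D B E A C] alt15[of B C E A D]
      alt35[of A D C E B] alt35[of A B C E D] alt35[of A C D E B]
    by (simp add: sum_perms_3 t_def field_simps)
  have "C311 g $ (E, D, A, B, C)
      = 3 / 10 * (sum_perms (\<lambda>X. k E (X ! 0) A (X ! 1) (X ! 2)) [D, B, C]
          + 2 / 3 * sum_perms (\<lambda>X. t E (X ! 0) A (X ! 1) (X ! 2)) [D, B, C])" for E D A B C
    by (simp add: C311_nth skew sum_perms_3) (simp add: field_simps)
  then have "C311 g $ (E, D, A, B, C) = g $ (E, D, A, B, C)" for E D A B C
    unfolding sum_k sum_t by simp
  then show ?thesis
    by (simp add: vec_eq_iff)
qed

lemma C311_idem: "C311 (C311 h) = C311 h"
proof (rule C311_eq_selfI)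
  define k where "k E D A B C = 3 / 10 * (skew5 h E D A B C + skew5 h E B A D C)" for E D A B C
  show "k A D E B C = - k E D A B C" for E D A B C
    by (simp add: k_def skew5_eq field_simps)
  show "k E D C B A = - k E D A B C" for E D A B C
    by (simp add: k_def skew5_eq field_simps)
  show "k E B A D C = k E D A B C" for E D A B C
    by (simp add: k_def add.commute)
  show "C311 h $ (E, D, A, B, C) = k E D A B C + k E D A C B + k E B A C D" for E D A B C
    by (simp add: k_def C311_nth sum_perms_3 algebra_simps)
qed

theorem proposition1p1:
  shows
    "(\<forall>h :: ('k::finite) tensor3.
        h \<in> V210 \<longleftrightarrow> (\<forall>A B C. skew3 h A B C + skew3 h A C B = 3 / 2 * h $ (A, B, C)))
   \<and> (\<forall>h :: 'k tensor3. h \<in> V210 \<longrightarrow> (\<forall>A B C. h $ (A, B, C) = h $ (A, C, B)))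
   \<and> (\<forall>h :: 'k tensor4.
        h \<in> V220 \<longleftrightarrow>
        (\<forall>D A B C. h $ (D, A, B, C) =
           1 / 6 * sum_perms (\<lambda>X. sum_perms (\<lambda>Y.
               skew4 h (X ! 1) (X ! 0) (Y ! 0) (Y ! 1) + skew4 h (Y ! 0) (Y ! 1) (X ! 1) (X ! 0))
             [B, C]) [A, D]))
   \<and> (\<forall>h :: 'k tensor5.
        h \<in> V3110 \<longleftrightarrow>
        (\<forall>E D A B C. sum_perms (\<lambda>X. skew5 h E (X ! 0) A (X ! 1) (X ! 2)) [D, B, C]
           = 10 / 3 * h $ (E, D, A, B, C)))"
proof (intro conjI allI)
  fix h :: "'k tensor3"
  have V210: "h \<in> V210 \<longleftrightarrow> C21 h = h"
    unfolding V210_def by (rule range_idempotent_iff) (rule C21_idem)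
  show "h \<in> V210 \<longleftrightarrow> (\<forall>A B C. skew3 h A B C + skew3 h A C B = 3 / 2 * h $ (A, B, C))"
    unfolding V210 by (auto simp: vec_eq_iff C21_nth field_simps)
  show "h \<in> V210 \<longrightarrow> (\<forall>A B C. h $ (A, B, C) = h $ (A, C, B))"
    unfolding V210 by (metis C21_nth add.commute)
next
  fix h :: "'k tensor4"
  have "h \<in> V220 \<longleftrightarrow> C22 h = h"
    unfolding V220_def by (rule range_idempotent_iff) (rule C22_idem)
  then show "h \<in> V220 \<longleftrightarrow> (\<forall>D A B C. h $ (D, A, B, C) =
      1 / 6 * sum_perms (\<lambda>X. sum_perms (\<lambda>Y.
          skew4 h (X ! 1) (X ! 0) (Y ! 0) (Y ! 1) + skew4 h (Y ! 0) (Y ! 1) (X ! 1) (X ! 0))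
        [B, C]) [A, D])"
    unfolding C22_nth[symmetric] by (auto simp: vec_eq_iff)
next
  fix h :: "'k tensor5"
  have scale: "3 / 10 * x = y \<longleftrightarrow> x = 10 / 3 * y" for x y :: complex
    by (auto simp: field_simps)
  have "h \<in> V3110 \<longleftrightarrow> C311 h = h"
    unfolding V3110_def by (rule range_idempotent_iff) (rule C311_idem)
  then show "h \<in> V3110 \<longleftrightarrow>
      (\<forall>E D A B C. sum_perms (\<lambda>X. skew5 h E (X ! 0) A (X ! 1) (X ! 2)) [D, B, C]
         = 10 / 3 * h $ (E, D, A, B, C))"
    unfolding scale[symmetric] C311_nth[symmetric] by (simp add: vec_eq_iff)
qed

end
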